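(* Let $S\subset\mathcal H$ be a super-discrete set of sites. Then every cell of the asymmetric tropical Voronoi diagram $\mathrm{VD}(S)$ (i.e. every nonempty intersection of a nonempty family of Voronoi regions $\mathrm{VR}_S(a)$, $a\in S$) is a max-tropical polyhedron.
   Context: Let $n\ge 2$ and $\mathcal H=\{x\in\mathbb R^n : x_1+\dots+x_n=0\}$; each class of $\mathbb R^n/\mathbb R\mathbf 1$ has a unique representative in $\mathcal H$, and we identify $\mathbb R^n/\mathbb R\mathbf 1\cong\mathcal H$. The asymmetric tropical distance is $d_\triangle(a,b)=\sum_{i=1}^n(b_i-a_i)+n\max_{i}(a_i-b_i)$. For a nonempty discrete set $S\subset\mathcal H$ (the sites) and $a\in S$, the Voronoi region is $\mathrm{VR}_S(a)=\{x\in\mathcal H: d_\triangle(x,a)\le d_\triangle(x,b)\ \forall b\in S\}$. The Voronoi diagram $\mathrm{VD}(S)$ is the poset (under inclusion) of all intersections of nonempty families of Voronoi regions (the Voronoi cells). A max-tropical halfspace is a set of the form $\{x\in\mathcal H:\max_{i\in I}(\alpha_i+x_i)\le\max_{j\in J}(\beta_j+x_j)\}$ with $I,J\subseteq[n]$ disjoint nonempty and $\alpha_i,\beta_j\in\mathbb R$; a max-tropical polyhedron is an intersection of finitely many max-tropical halfspaces. A set $S\subset\mathcal H$ is super-discrete if for every $i\in[n]$ the coordinate projection $\{s_i: s\in S\}$ is a discrete subset of $\mathbb R$. *)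

theory Defs
  imports "HOL-Analysis.Analysis"
begin

definition trop_hyperplane :: "(real ^ 'n) set" where
  "trop_hyperplane = {x. (\<Sum>i\<in>UNIV. x $ i) = 0}"

definition asym_dist :: "real ^ 'n \<Rightarrow> real ^ 'n \<Rightarrow> real" where
  "asym_dist a b =
     (\<Sum>i\<in>UNIV. b $ i - a $ i) + real CARD('n) * (MAX i\<in>UNIV. a $ i - b $ i)"

text \<open>
  A discrete set of sites is one without accumulation points in the ambient space, that is,
  closed and discrete. The library constant \<^const>\<open>discrete\<close> alone only says that every point
  of the set is isolated in the set, so it admits \<open>{1 / k | k. k \<ge> 1}\<close>. With that weaker
  reading of super-discreteness Voronoi regions need not be polyhedra: for the sites
  \<open>a = (-2, 1, 1)\<close> and \<open>b k = (0, - 1 / k, 1 / k)\<close> with \<open>k \<ge> 1\<close>, the region of \<open>a\<close> is bounded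
  by a staircase with infinitely many steps.
\<close>

definition closed_discrete :: "'a::topological_space set \<Rightarrow> bool" where
  "closed_discrete S \<longleftrightarrow> closed S \<and> discrete S"

definition site_set :: "(real ^ 'n) set \<Rightarrow> bool" where
  "site_set S \<longleftrightarrow> S \<noteq> {} \<and> S \<subseteq> trop_hyperplane \<and> closed_discrete S"

definition super_discrete :: "(real ^ 'n) set \<Rightarrow> bool" where
  "super_discrete S \<longleftrightarrow> (\<forall>i. closed_discrete ((\<lambda>s. s $ i) ` S))"

definition voronoi_region :: "(real ^ 'n) set \<Rightarrow> real ^ 'n \<Rightarrow> (real ^ 'n) set" where
  "voronoi_region S a = {x \<in> trop_hyperplane. \<forall>b\<in>S. asym_dist x a \<le> asym_dist x b}"

definition voronoi_diagram :: "(real ^ 'n) set \<Rightarrow> (real ^ 'n) set set" where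
  "voronoi_diagram S = {\<Inter>a\<in>A. voronoi_region S a | A. A \<noteq> {} \<and> A \<subseteq> S}"

definition max_tropical_halfspace :: "(real ^ 'n) set \<Rightarrow> bool" where
  "max_tropical_halfspace P \<longleftrightarrow>
     (\<exists>I J. \<exists>\<alpha> \<beta> :: 'n \<Rightarrow> real. I \<noteq> {} \<and> J \<noteq> {} \<and> I \<inter> J = {} \<and>
        P = {x \<in> trop_hyperplane. (MAX i\<in>I. \<alpha> i + x $ i) \<le> (MAX j\<in>J. \<beta> j + x $ j)})"

text \<open>
  Intersections are taken inside the hyperplane, so the empty family yields the whole
  hyperplane. It is not a halfspace, but it is the Voronoi region of a single site.
\<close>

definition max_tropical_polyhedron :: "(real ^ 'n) set \<Rightarrow> bool" where
  "max_tropical_polyhedron P \<longleftrightarrow>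
     (\<exists>\<H>. finite \<H> \<and> (\<forall>h\<in>\<H>. max_tropical_halfspace h) \<and> P = trop_hyperplane \<inter> \<Inter>\<H>)"

end

theory Submission
  imports Defs
begin

text \<open>
  On the hyperplane the distance from \<open>x\<close> to \<open>a\<close> is \<open>n max (x i - a i)\<close>, so \<open>x\<close> is at least as
  close to \<open>a\<close> as to \<open>b\<close> iff every \<open>i\<close> with \<open>a i < b i\<close> admits some \<open>j\<close> with \<open>b j \<le> a j\<close> and
  \<open>x i - a i \<le> x j - b j\<close>. This is a halfspace, and among the sites \<open>b\<close> with the same index set
  \<open>J = {j. b j \<le> a j}\<close> it shrinks as the numbers \<open>a j - b j \<ge> 0\<close>, \<open>j \<in> J\<close>, decrease. By
  super-discreteness these numbers range over sets in which every bounded part is finite, so by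
  Dickson's lemma finitely many sites dominate all others. Hence regions are polyhedra. A nonempty
  cell is an intersection of finitely many regions, because all sites at the same distance from a
  point lie in a bounded set.
\<close>

section \<open>Finiteness from Dickson's lemma and from compactness\<close>

text \<open>Finiteness of each coordinate's values below a bound takes the place of well-ordering.
  Induction on \<open>J\<close>: a basis for the old coordinates also dominates every
  \<open>t\<close> whose new coordinate is large, and the finitely many small values of that
  coordinate are treated one fibre at a time.\<close>

lemma dickson_finite_basis:
  fixes f :: "'b \<Rightarrow> 'k \<Rightarrow> 'v::linorder"
  assumes "finite J"
    and "\<And>k v. k \<in> J \<Longrightarrow> finite {w \<in> (\<lambda>t. f t k) ` T. w \<le> v}"
  shows "\<exists>M. finite M \<and> M \<subseteq> T \<and> (\<forall>t\<in>T. \<exists>m\<in>M. \<forall>k\<in>J. f m k \<le> f t k)"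
  using assms
proof (induction J arbitrary: T rule: finite_induct)
  case empty
  show ?case
  proof (cases "T = {}")
    case False
    then obtain t where "t \<in> T" by blast
    then show ?thesis by (intro exI[of _ "{t}"]) auto
  qed auto
next
  case (insert k J)
  \<comment> \<open>The induction hypothesis is needed for \<open>T\<close> itself and for each
    fibre of coordinate \<open>k\<close>.\<close>
  have basis: "\<exists>M. finite M \<and> M \<subseteq> U \<and> (\<forall>t\<in>U. \<exists>m\<in>M. \<forall>k\<in>J. f m k \<le> f t k)"
    if "U \<subseteq> T" for U
  proof (rule insert.IH)
    fix l v assume "l \<in> J"
    then have "finite {w \<in> (\<lambda>t. f t l) ` T. w \<le> v}" by (intro insert.prems) simp
    then show "finite {w \<in> (\<lambda>t. f t l) ` U. w \<le> v}"
      by (rule finite_subset[rotated]) (use that in auto)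
  qed
  obtain M where M: "finite M" "M \<subseteq> T" "\<And>t. t \<in> T \<Longrightarrow> \<exists>m\<in>M. \<forall>k\<in>J. f m k \<le> f t k"
    using basis[of T] by blast
  show ?case
  proof (cases "T = {}")
    case False
    with M have "M \<noteq> {}" by blast
    \<comment> \<open>Above the threshold \<open>v\<close>, every element of \<open>M\<close> is
      automatically at most \<open>t\<close> in coordinate \<open>k\<close>.\<close>
    define v where "v = (MAX m\<in>M. f m k)"
    have v: "f m k \<le> v" if "m \<in> M" for m
      unfolding v_def using M(1) that by simp
    define W where "W = {w \<in> (\<lambda>t. f t k) ` T. w \<le> v}"
    have "finite W" unfolding W_def by (rule insert.prems) simp
    have "\<exists>N. \<forall>w. finite (N w) \<and> N w \<subseteq> {t \<in> T. f t k = w} \<and>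
        (\<forall>t\<in>{t \<in> T. f t k = w}. \<exists>m\<in>N w. \<forall>k\<in>J. f m k \<le> f t k)"
      by (intro choice allI basis) auto
    then obtain N where N: "\<forall>w. finite (N w) \<and> N w \<subseteq> {t \<in> T. f t k = w} \<and>
        (\<forall>t\<in>{t \<in> T. f t k = w}. \<exists>m\<in>N w. \<forall>k\<in>J. f m k \<le> f t k)" ..
    then have N_fin: "finite (N w)" and N_sub: "N w \<subseteq> {t \<in> T. f t k = w}" for w
      by auto
    have N_dom: "\<exists>m\<in>N (f t k). \<forall>k\<in>J. f m k \<le> f t k" if "t \<in> T" for t
      using N that by simp
    have "\<exists>m\<in>M \<union> (\<Union>w\<in>W. N w). \<forall>l\<in>insert k J. f m l \<le> f t l" if t: "t \<in> T" for t
    proof (cases "f t k \<le> v")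
      case True
      then have "f t k \<in> W" using t by (auto simp: W_def)
      moreover obtain m where "m \<in> N (f t k)" "\<forall>l\<in>J. f m l \<le> f t l"
        using N_dom[OF t] by blast
      moreover from this have "f m k = f t k" using N_sub by blast
      ultimately show ?thesis by (intro bexI[of _ m]) auto
    next
      case False
      obtain m where "m \<in> M" "\<forall>l\<in>J. f m l \<le> f t l" using M(3)[OF t] by blast
      moreover have "f m k \<le> f t k" using v[OF \<open>m \<in> M\<close>] False by simp
      ultimately show ?thesis by auto
    qed
    moreover have "finite (M \<union> (\<Union>w\<in>W. N w))" using M(1) \<open>finite W\<close> N_fin by simp
    moreover have "M \<union> (\<Union>w\<in>W. N w) \<subseteq> T" using M(2) N_sub by blast
    ultimately show ?thesis by (intro exI[of _ "M \<union> (\<Union>w\<in>W. N w)"]) blast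
  qed auto
qed

lemma closed_discrete_Int_compact_finite:
  fixes X :: "'a::metric_space set"
  assumes "closed_discrete X" "compact K"
  shows "finite (X \<inter> K)"
proof -
  have "compact (X \<inter> K)"
    using assms by (simp add: closed_discrete_def closed_Int_compact)
  moreover have "discrete (X \<inter> K)"
    using assms by (auto simp: closed_discrete_def intro: discrete_subset)
  ultimately show ?thesis using discrete_compact_finite_iff by blast
qed

section \<open>Tropical distance and bisectors\<close>

lemma asym_dist_trop_hyperplane:
  fixes x a :: "real ^ 'n"
  assumes "x \<in> trop_hyperplane" "a \<in> trop_hyperplane"
  shows "asym_dist x a = real CARD('n) * (MAX i\<in>UNIV. x $ i - a $ i)"
  using assms by (simp add: asym_dist_def trop_hyperplane_def sum_subtractf)

lemma Max_image_le_Max_image_iff: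
  fixes f :: "'a \<Rightarrow> 'c::linorder" and g :: "'b \<Rightarrow> 'c"
  assumes "finite I" "I \<noteq> {}" "finite J" "J \<noteq> {}"
  shows "(MAX i\<in>I. f i) \<le> (MAX j\<in>J. g j) \<longleftrightarrow> (\<forall>i\<in>I. \<exists>j\<in>J. f i \<le> g j)"
  using assms by (subst Max_le_iff) (simp_all add: Max_ge_iff)

text \<open>Comparing two maxima over all indices is brought to a form with disjoint index sets, as
  a halfspace requires. An index \<open>i\<close> with \<open>b $ i \<le> a $ i\<close> is its own
  witness, and the index attaining the larger maximum always lies on the right-hand side.\<close>

lemma asym_dist_le_iff:
  fixes x a b :: "real ^ 'n"
  assumes "x \<in> trop_hyperplane" "a \<in> trop_hyperplane" "b \<in> trop_hyperplane"
  shows "asym_dist x a \<le> asym_dist x b \<longleftrightarrow>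
    (\<forall>i. a $ i < b $ i \<longrightarrow> (\<exists>j. b $ j \<le> a $ j \<and> x $ i - a $ i \<le> x $ j - b $ j))"
    (is "_ \<longleftrightarrow> ?R")
proof -
  have "asym_dist x a \<le> asym_dist x b \<longleftrightarrow>
      (MAX i\<in>UNIV. x $ i - a $ i) \<le> (MAX j\<in>UNIV. x $ j - b $ j)"
    using assms by (simp add: asym_dist_trop_hyperplane)
  also have "\<dots> \<longleftrightarrow> (\<forall>i. \<exists>j. x $ i - a $ i \<le> x $ j - b $ j)"
    by (subst Max_image_le_Max_image_iff) auto
  also have "\<dots> \<longleftrightarrow> ?R"
  proof
    assume L: "\<forall>i. \<exists>j. x $ i - a $ i \<le> x $ j - b $ j"
    have "(MAX j\<in>UNIV. x $ j - b $ j) \<in> range (\<lambda>j. x $ j - b $ j)" by (intro Max_in) auto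
    then obtain j where j: "(MAX j\<in>UNIV. x $ j - b $ j) = x $ j - b $ j" by blast
    have "x $ k - b $ k \<le> x $ j - b $ j" for k
      unfolding j[symmetric] by (rule Max_ge) auto
    then have "x $ i - a $ i \<le> x $ j - b $ j" for i
      using L order_trans by meson
    \<comment> \<open>At \<open>i = j\<close> the term \<open>x $ j\<close> cancels.\<close>
    moreover from this[of j] have "b $ j \<le> a $ j" by simp
    ultimately show ?R by blast
  next
    assume R: ?R
    show "\<forall>i. \<exists>j. x $ i - a $ i \<le> x $ j - b $ j"
    proof
      fix i
      show "\<exists>j. x $ i - a $ i \<le> x $ j - b $ j"
      proof (cases "a $ i < b $ i")
        case False
        then show ?thesis by (intro exI[of _ i]) simp
      qed (use R in blast)
    qed
  qed
  finally show ?thesis .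
qed

lemma trop_hyperplane_le_imp_eq:
  fixes a b :: "real ^ 'n"
  assumes "a \<in> trop_hyperplane" "b \<in> trop_hyperplane" "\<And>i. b $ i \<le> a $ i"
  shows "a = b"
proof -
  have "(\<Sum>i\<in>UNIV. a $ i - b $ i) = 0"
    using assms by (simp add: trop_hyperplane_def sum_subtractf)
  then have "\<forall>i. a $ i - b $ i = 0"
    using assms(3) by (subst (asm) sum_nonneg_eq_0_iff) auto
  then show ?thesis by (simp add: vec_eq_iff)
qed

text \<open>Distinct points with equal coordinate sum are incomparable coordinatewise, which makes
  both index sets nonempty.\<close>

lemma max_tropical_halfspace_bisector:
  fixes a b :: "real ^ 'n"
  assumes a: "a \<in> trop_hyperplane" and b: "b \<in> trop_hyperplane" and "a \<noteq> b"
  shows "max_tropical_halfspace {x \<in> trop_hyperplane. asym_dist x a \<le> asym_dist x b}"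
proof -
  define I where "I = {i. a $ i < b $ i}"
  define J where "J = {j. b $ j \<le> a $ j}"
  have "I \<noteq> {}"
    using trop_hyperplane_le_imp_eq[OF a b] \<open>a \<noteq> b\<close> unfolding I_def
    by (metis (mono_tags) empty_Collect_eq not_less)
  moreover have "J \<noteq> {}"
    using trop_hyperplane_le_imp_eq[OF b a] \<open>a \<noteq> b\<close> unfolding J_def
    by (metis (mono_tags) empty_Collect_eq linear)
  moreover have "I \<inter> J = {}" by (auto simp: I_def J_def)
  moreover have "asym_dist x a \<le> asym_dist x b \<longleftrightarrow>
      (MAX i\<in>I. - a $ i + x $ i) \<le> (MAX j\<in>J. - b $ j + x $ j)" if "x \<in> trop_hyperplane" for x
    using \<open>I \<noteq> {}\<close> \<open>J \<noteq> {}\<close> that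
    by (subst Max_image_le_Max_image_iff)
      (simp_all add: asym_dist_le_iff[OF _ a b] I_def J_def add.commute)
  ultimately show ?thesis
    unfolding max_tropical_halfspace_def
    by (intro exI[of _ I] exI[of _ J] exI[of _ "\<lambda>i. - a $ i"] exI[of _ "\<lambda>j. - b $ j"]) auto
qed

lemma max_tropical_polyhedron_INT:
  assumes "finite A" "A \<noteq> {}" "\<And>a. a \<in> A \<Longrightarrow> max_tropical_polyhedron (P a)"
  shows "max_tropical_polyhedron (\<Inter>a\<in>A. P a)"
proof -
  from assms(3) obtain \<H> where \<H>: "\<And>a. a \<in> A \<Longrightarrow> finite (\<H> a)"
    "\<And>a h. a \<in> A \<Longrightarrow> h \<in> \<H> a \<Longrightarrow> max_tropical_halfspace h"
    "\<And>a. a \<in> A \<Longrightarrow> P a = trop_hyperplane \<inter> \<Inter>(\<H> a)"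
    unfolding max_tropical_polyhedron_def by metis
  have "(\<Inter>a\<in>A. P a) = trop_hyperplane \<inter> \<Inter>(\<Union>a\<in>A. \<H> a)"
    using \<H>(3) assms(2) by auto
  then show ?thesis
    unfolding max_tropical_polyhedron_def using \<H>(1,2) assms(1)
    by (intro exI[of _ "\<Union>a\<in>A. \<H> a"]) auto
qed

section \<open>Voronoi regions\<close>

text \<open>Dickson's lemma is applied separately to each class of sites with a common index set
  \<open>J\<close>; there are only finitely many such sets.\<close>

lemma finite_dominating_sites:
  fixes S :: "(real ^ 'n) set"
  assumes "super_discrete S"
  shows "\<exists>M. finite M \<and> M \<subseteq> S \<and>
    (\<forall>b\<in>S. \<exists>m\<in>M. \<forall>j. (m $ j \<le> a $ j \<longleftrightarrow> b $ j \<le> a $ j) \<and> (b $ j \<le> a $ j \<longrightarrow> b $ j \<le> m $ j))"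
proof -
  define T where "T J = {b \<in> S. {j. b $ j \<le> a $ j} = J}" for J
  have "\<exists>M. finite M \<and> M \<subseteq> T J \<and> (\<forall>b\<in>T J. \<exists>m\<in>M. \<forall>j\<in>J. a $ j - m $ j \<le> a $ j - b $ j)" for J
  proof (rule dickson_finite_basis)
    fix j v assume "j \<in> J"
    \<comment> \<open>For \<open>b\<close> in \<open>T J\<close> and \<open>j\<close> in
      \<open>J\<close>, \<open>a $ j - b $ j\<close> is nonnegative, so the bound \<open>v\<close>
      confines \<open>b $ j\<close> to a compact interval.\<close>
    let ?K = "(\<lambda>s. s $ j) ` S \<inter> {a $ j - v..a $ j}"
    have "finite ?K"
      using assms by (intro closed_discrete_Int_compact_finite) (auto simp: super_discrete_def)
    then have "finite ((\<lambda>u. a $ j - u) ` ?K)" by simp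
    moreover have "{w \<in> (\<lambda>b. a $ j - b $ j) ` T J. w \<le> v} \<subseteq> (\<lambda>u. a $ j - u) ` ?K"
      using \<open>j \<in> J\<close> by (auto simp: T_def)
    ultimately show "finite {w \<in> (\<lambda>b. a $ j - b $ j) ` T J. w \<le> v}"
      by (rule finite_subset[rotated])
  qed simp
  then obtain M where M: "\<And>J. finite (M J)" "\<And>J. M J \<subseteq> T J"
    "\<And>J b. b \<in> T J \<Longrightarrow> \<exists>m\<in>M J. \<forall>j\<in>J. a $ j - m $ j \<le> a $ j - b $ j"
    by metis
  have "\<exists>m\<in>\<Union>(range M). \<forall>j. (m $ j \<le> a $ j \<longleftrightarrow> b $ j \<le> a $ j) \<and> (b $ j \<le> a $ j \<longrightarrow> b $ j \<le> m $ j)"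
    if "b \<in> S" for b
  proof -
    let ?J = "{j. b $ j \<le> a $ j}"
    have "b \<in> T ?J" using that by (simp add: T_def)
    then obtain m where m: "m \<in> M ?J" "\<forall>j\<in>?J. a $ j - m $ j \<le> a $ j - b $ j"
      using M(3) by blast
    moreover have "{j. m $ j \<le> a $ j} = ?J" using m(1) M(2)[of ?J] by (auto simp: T_def)
    ultimately show ?thesis by (intro bexI[of _ m]) auto
  qed
  moreover have "finite (\<Union>(range M))" using M(1) by simp
  moreover have "\<Union>(range M) \<subseteq> S" using M(2) by (auto simp: T_def)
  ultimately show ?thesis by blast
qed

lemma max_tropical_polyhedron_voronoi_region:
  fixes S :: "(real ^ 'n) set"
  assumes S: "S \<subseteq> trop_hyperplane" and "super_discrete S" and "a \<in> S"
  shows "max_tropical_polyhedron (voronoi_region S a)"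
proof -
  obtain M where M: "finite M" "M \<subseteq> S" and dom: "\<And>b. b \<in> S \<Longrightarrow> \<exists>m\<in>M. \<forall>j.
      (m $ j \<le> a $ j \<longleftrightarrow> b $ j \<le> a $ j) \<and> (b $ j \<le> a $ j \<longrightarrow> b $ j \<le> m $ j)"
    using finite_dominating_sites[OF assms(2), of a] by blast
  define D where "D b = {x \<in> trop_hyperplane. asym_dist x a \<le> asym_dist x b}" for b
  \<comment> \<open>The dominating \<open>m\<close> shares its index sets with \<open>b\<close>, and
    \<open>b $ j \<le> m $ j\<close> on the right-hand side makes its condition the stronger
    one.\<close>
  have sub: "\<exists>m\<in>M. D m \<subseteq> D b" if "b \<in> S" for b
  proof -
    obtain m where m: "m \<in> M" "\<And>j. m $ j \<le> a $ j \<longleftrightarrow> b $ j \<le> a $ j"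
      "\<And>j. b $ j \<le> a $ j \<Longrightarrow> b $ j \<le> m $ j"
      using dom[OF \<open>b \<in> S\<close>] by blast
    have H: "a \<in> trop_hyperplane" "m \<in> trop_hyperplane" "b \<in> trop_hyperplane"
      using S \<open>a \<in> S\<close> \<open>b \<in> S\<close> m(1) M(2) by auto
    have "x \<in> D b" if "x \<in> D m" for x
    proof -
      have x: "x \<in> trop_hyperplane" using that by (simp add: D_def)
      have "\<exists>j. b $ j \<le> a $ j \<and> x $ i - a $ i \<le> x $ j - b $ j" if "a $ i < b $ i" for i
      proof -
        have "a $ i < m $ i" using m(2)[of i] that by linarith
        then obtain j where j: "m $ j \<le> a $ j" "x $ i - a $ i \<le> x $ j - m $ j"
          using \<open>x \<in> D m\<close> x H by (auto simp: D_def asym_dist_le_iff)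
        then show ?thesis using m(2)[of j] m(3)[of j] by (intro exI[of _ j]) auto
      qed
      then show ?thesis using x H by (simp add: D_def asym_dist_le_iff)
    qed
    then show ?thesis using m(1) by blast
  qed
  have "voronoi_region S a = trop_hyperplane \<inter> (\<Inter>b\<in>S. D b)"
    by (auto simp: voronoi_region_def D_def)
  \<comment> \<open>The site \<open>a\<close> must be dropped: \<open>D a\<close> is the whole
    hyperplane, which is not a halfspace.\<close>
  also have "\<dots> = trop_hyperplane \<inter> (\<Inter>b\<in>M - {a}. D b)"
  proof -
    have "D a = trop_hyperplane" by (auto simp: D_def)
    then show ?thesis using sub M(2) by blast
  qed
  finally have "voronoi_region S a = trop_hyperplane \<inter> \<Inter>(D ` (M - {a}))" .
  moreover have "\<forall>h\<in>D ` (M - {a}). max_tropical_halfspace h"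
    unfolding D_def using S M(2) \<open>a \<in> S\<close>
    by (auto intro!: max_tropical_halfspace_bisector)
  ultimately show ?thesis
    unfolding max_tropical_polyhedron_def using M(1)
    by (intro exI[of _ "D ` (M - {a})"]) simp
qed

section \<open>Finiteness of the sites meeting in a cell\<close>

text \<open>The distance bounds the coordinates of \<open>a - x\<close> only from below; since they
  sum to zero, upper bounds follow.\<close>

lemma bounded_asym_dist_cball:
  fixes x :: "real ^ 'n"
  assumes "x \<in> trop_hyperplane"
  shows "bounded {a \<in> trop_hyperplane. asym_dist x a \<le> r}"
proof -
  define c where "c = r / real CARD('n)"
  have norm: "norm (a - x) \<le> real CARD('n) * (2 * \<bar>c\<bar> + real CARD('n) * \<bar>c\<bar>)"
    if a: "a \<in> trop_hyperplane" "asym_dist x a \<le> r" for a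
  proof -
    have "(MAX i\<in>UNIV. x $ i - a $ i) \<le> c"
      using a assms by (simp add: asym_dist_trop_hyperplane c_def field_simps)
    then have lo: "x $ i - a $ i \<le> c" for i
      by (subst (asm) Max_le_iff) auto
    have "\<bar>(a - x) $ i\<bar> \<le> 2 * \<bar>c\<bar> + real CARD('n) * \<bar>c\<bar>" for i
    proof -
      \<comment> \<open>After the shift by \<open>\<bar>c\<bar>\<close> all terms are nonnegative,
        so each is at most their sum.\<close>
      have nn: "0 \<le> a $ k - x $ k + \<bar>c\<bar>" for k using lo[of k] by linarith
      have "a $ i - x $ i + \<bar>c\<bar> \<le> (\<Sum>k\<in>UNIV. a $ k - x $ k + \<bar>c\<bar>)"
        using nn by (intro member_le_sum) auto
      also have "\<dots> = real CARD('n) * \<bar>c\<bar>"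
        using a assms by (simp add: sum.distrib sum_subtractf trop_hyperplane_def)
      finally have "a $ i - x $ i + \<bar>c\<bar> \<le> real CARD('n) * \<bar>c\<bar>" .
      moreover have "0 \<le> real CARD('n) * \<bar>c\<bar>" by simp
      ultimately show ?thesis using nn[of i] 
        unfolding abs_le_iff vector_minus_component by linarith
    qed
    then have "(\<Sum>i\<in>UNIV. \<bar>(a - x) $ i\<bar>) \<le> real CARD('n) * (2 * \<bar>c\<bar> + real CARD('n) * \<bar>c\<bar>)"
      using sum_bounded_above[of UNIV "\<lambda>i. \<bar>(a - x) $ i\<bar>"] by simp
    then show ?thesis using norm_le_l1_cart[of "a - x"] by linarith
  qed
  then show ?thesis
    by (intro bounded_subset[OF bounded_cball[of x]]) (auto simp: dist_norm norm_minus_commute)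
qed

text \<open>A common point \<open>x\<close> of the regions is no farther from any site in
  \<open>A\<close> than from a fixed \<open>a\<^sub>0\<close> in \<open>A\<close>, so
  \<open>A\<close> lies in a bounded ball. The closure of that ball supplies compactness.\<close>

lemma finite_sites_of_voronoi_cell:
  fixes S :: "(real ^ 'n) set"
  assumes S: "S \<subseteq> trop_hyperplane" "closed_discrete S"
    and A: "A \<subseteq> S" "A \<noteq> {}" and x: "x \<in> (\<Inter>a\<in>A. voronoi_region S a)"
  shows "finite A"
proof -
  obtain a\<^sub>0 where a\<^sub>0: "a\<^sub>0 \<in> A" using A(2) by blast
  let ?B = "{a \<in> trop_hyperplane. asym_dist x a \<le> asym_dist x a\<^sub>0}"
  have "x \<in> trop_hyperplane" using x a\<^sub>0 by (auto simp: voronoi_region_def)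
  then have "compact (closure ?B)" by (simp add: bounded_asym_dist_cball)
  then have "finite (S \<inter> closure ?B)" by (rule closed_discrete_Int_compact_finite[OF S(2)])
  moreover have "A \<subseteq> ?B" using x a\<^sub>0 A(1) S(1) by (auto simp: voronoi_region_def)
  then have "A \<subseteq> S \<inter> closure ?B" using A(1) closure_subset by blast
  ultimately show ?thesis by (rule finite_subset[rotated])
qed

theorem theorem4p10:
  fixes S :: "(real ^ 'n) set"
  assumes "CARD('n) \<ge> 2"
    and "site_set S"
    and "super_discrete S"
  shows "\<forall>C\<in>voronoi_diagram S. C \<noteq> {} \<longrightarrow> max_tropical_polyhedron C"
proof (intro ballI impI)
  fix C assume "C \<in> voronoi_diagram S" "C \<noteq> {}"
  then obtain A x where A: "A \<noteq> {}" "A \<subseteq> S" "C = (\<Inter>a\<in>A. voronoi_region S a)" and "x \<in> C"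
    by (auto simp: voronoi_diagram_def)
  have S: "S \<subseteq> trop_hyperplane" "closed_discrete S"
    using assms(2) by (auto simp: site_set_def)
  have "finite A" using finite_sites_of_voronoi_cell[OF S A(2,1)] A(3) \<open>x \<in> C\<close> by blast
  then show "max_tropical_polyhedron C"
    unfolding A(3) using max_tropical_polyhedron_voronoi_region[OF S(1) assms(3)] A(1,2)
    by (intro max_tropical_polyhedron_INT) auto
qed

end
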